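(* Let $d\ge 2$ be an integer and set $t_d:=2^{d-1}-1$. There exist constants $C_d,c_d>0$ depending only on $d$ such that the following holds. Let $m\ge 1$, let $A\subset\mathbb{Z}^m$ be finite and nonempty, and suppose that $A$ contains a $d$-dimensional spherical Freiman model $D$, i.e. a nonempty subset $D\subseteq A$ that is Freiman isomorphic, of some order $h\geq 2$, to a subset $S\subseteq \mathcal{F}_{d,R^2}$ for some positive integer $R$. Put $\alpha:=|D|/|A|$. Then for every $\eta\in(0,1)$ there are affine subspaces $P_1,\dots,P_J\subset\mathbb{R}^d$, each of dimension at most one, such that $$\Big|S\cap\bigcup_{j=1}^J P_j\Big|\ge (1-\eta)|S|,\qquad J\le C_d\Big(\eta^{-2}\frac{\|A\|^2}{\alpha}\Big)^{t_d}.$$ Consequently, $$\|A\|\ge c_d\,|A|^{1/(2t_d)}\,\alpha^{(t_d+1)/(2t_d)}.$$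
   Context: For a finite set $A\subset\mathbb{Z}^m$, the Fourier $L^1$ norm is $\|A\|:=\int_{\mathbb{T}^m}\big|\sum_{a\in A}e(a\cdot t)\big|\,dt$, where $e(x)=e^{2\pi i x}$ and $\mathbb{T}=\mathbb{R}/\mathbb{Z}$. For a positive integer $R$, $\mathcal{F}_{d,R^2}:=\{x\in\mathbb{Z}^d: |x|^2=R^2\}$ (Euclidean norm). A map $\phi:D\to D'$ between subsets of abelian groups is a Freiman $h$-homomorphism if $d_1+\cdots+d_h=d_{h+1}+\cdots+d_{2h}$ with all $d_i\in D$ implies $\phi(d_1)+\cdots+\phi(d_h)=\phi(d_{h+1})+\cdots+\phi(d_{2h})$. A Freiman $h$-isomorphism is a bijection for which this implication holds in both directions. *)

theory Defs
  imports "HOL-Analysis.Analysis" "HOL-Library.Function_Algebras"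
begin

text \<open>The dimension \<open>m\<close> varies inside the main statement, so \<open>\<int>\<^sup>m\<close> is realised as the
  additive group of integer sequences vanishing from index \<open>m\<close> on, with pointwise addition.\<close>

definition int_lattice :: "nat \<Rightarrow> (nat \<Rightarrow> int) set" where
  "int_lattice m = {a. \<forall>i\<ge>m. a i = 0}"

text \<open>Normalised Haar measure on \<open>(\<real>/\<int>)\<^sup>m\<close>, carried by the fundamental domain \<open>[0,1)\<^sup>m\<close>.\<close>

definition torus_measure :: "nat \<Rightarrow> (nat \<Rightarrow> real) measure" where
  "torus_measure m = (\<Pi>\<^sub>M i\<in>{..<m}. restrict_space lborel {0..<1})"

definition add_char :: "real \<Rightarrow> complex" where
  "add_char x = exp (2 * pi * \<i> * x)"

definition fourier_L1_norm :: "nat \<Rightarrow> (nat \<Rightarrow> int) set \<Rightarrow> real" where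
  "fourier_L1_norm m A =
     (LINT t|torus_measure m. norm (\<Sum>a\<in>A. add_char (\<Sum>i<m. of_int (a i) * t i)))"

text \<open>\<open>\<int>\<^sup>d\<close> is taken as the set of points of \<open>\<real>\<^sup>d\<close> with integer coordinates.\<close>

definition lattice_sphere :: "nat \<Rightarrow> (real ^ 'd) set" where
  "lattice_sphere R = {x. (\<forall>i. x $ i \<in> \<int>) \<and> (norm x)\<^sup>2 = (real R)\<^sup>2}"

definition freiman_iso ::
  "nat \<Rightarrow> ('a::ab_group_add \<Rightarrow> 'b::ab_group_add) \<Rightarrow> 'a set \<Rightarrow> 'b set \<Rightarrow> bool" where
  "freiman_iso h \<phi> D D' \<longleftrightarrow>
     bij_betw \<phi> D D' \<and>
     (\<forall>x :: nat \<Rightarrow> 'a. (\<forall>i\<in>{1..2*h}. x i \<in> D) \<longrightarrow>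
        ((\<Sum>i=1..h. x i) = (\<Sum>i=h+1..2*h. x i) \<longleftrightarrow>
         (\<Sum>i=1..h. \<phi> (x i)) = (\<Sum>i=h+1..2*h. \<phi> (x i))))"

definition t_exp :: "nat \<Rightarrow> nat" where
  "t_exp d = 2 ^ (d - 1) - 1"

end

theory Submission
  imports Defs
begin

text \<open>
  Write \<open>M = \<parallel>A\<parallel>\<^sup>2 |A|\<close>. Applying Cauchy--Schwarz twice to the inner product of the exponential sums
  of \<open>A\<close> and of a subset \<open>Y \<subseteq> A\<close> gives \<open>|Y|\<^sup>4 \<le> M E(Y)\<close>, where \<open>E\<close> is the additive energy,
  a Freiman invariant of order two. On a sphere the solutions of \<open>x + y = v\<close> lie in the hyperplane
  \<open>2 (v \<bullet> x) = |v|\<^sup>2\<close>, which cuts a given affine subspace in smaller dimension except for a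
  single \<open>v\<close> (twice the centre of the section). By induction on the dimension, a spherical set in
  \<open>\<real>\<^sup>d\<close> whose subsets \<open>Y\<close> all satisfy \<open>|Y|\<^sup>4 \<le> M E(Y)\<close> has at most \<open>2 M\<^bsup>1 - 1/2^(d-1)\<^esup>\<close> elements.
  So \<open>S\<close> itself is so small that its points can serve as the affine subspaces.
\<close>

section \<open>Additive energy\<close>

text \<open>Counting pairs of pairs makes this the coincidence count of
  \<open>integral_exponential_sum_norm_sq\<close> for the family of sums indexed by
  \<open>X \<times> X\<close>.\<close>

definition additive_energy :: "'a::ab_group_add set \<Rightarrow> nat" where
  "additive_energy X =
     card {(p, q). p \<in> X \<times> X \<and> q \<in> X \<times> X \<and> fst p + snd p = fst q + snd q}"

text \<open>The energy sums, over all pairs \<open>p\<close>, the number of representations of the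
  sum of \<open>p\<close>. At most \<open>card X\<close> pairs have sum \<open>v0\<close>, each
  contributing at most \<open>card X\<close>; this gives the \<open>+ 1\<close>. Every other pair
  contributes at most \<open>N\<close>.\<close>

lemma additive_energy_le:
  fixes X :: "'a::ab_group_add set"
  assumes fin: "finite X"
    and rep: "\<And>v. v \<noteq> v0 \<Longrightarrow> card {x \<in> X. v - x \<in> X} \<le> N"
  shows "additive_energy X \<le> (card X)\<^sup>2 * (N + 1)"
proof -
  let ?r = "\<lambda>v. card {x \<in> X. v - x \<in> X}"
  let ?s = "\<lambda>p::'a \<times> 'a. fst p + snd p"
  have fibre: "card {q \<in> X \<times> X. ?s q = v} = ?r v" for v
  proof (rule bij_betw_same_card[of fst])
    show "bij_betw fst {q \<in> X \<times> X. ?s q = v} {x \<in> X. v - x \<in> X}"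
      by (rule bij_betw_byWitness[where f' = "\<lambda>x. (x, v - x)"]) auto
  qed
  have r_le: "?r v \<le> card X" for v
    by (rule card_mono) (use fin in auto)
  have "{(p, q). p \<in> X \<times> X \<and> q \<in> X \<times> X \<and> ?s p = ?s q}
      = (SIGMA p : X \<times> X. {q \<in> X \<times> X. ?s q = ?s p})"
    by auto
  then have "additive_energy X = (\<Sum>p\<in>X \<times> X. ?r (?s p))"
    unfolding additive_energy_def using fin by (simp add: card_SigmaI fibre)
  also have "\<dots> \<le> (\<Sum>p\<in>X \<times> X. N + (if ?s p = v0 then card X else 0))"
    using rep r_le by (intro sum_mono) (auto intro: trans_le_add2)
  also have "\<dots> = (card X)\<^sup>2 * N + (\<Sum>p\<in>X \<times> X. if ?s p = v0 then card X else 0)"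
    by (simp add: sum.distrib card_cartesian_product power2_eq_square)
  also have "(\<Sum>p\<in>X \<times> X. if ?s p = v0 then card X else 0)
      = card {q \<in> X \<times> X. ?s q = v0} * card X"
    using fin by (simp add: sum.If_cases Int_def)
  also have "\<dots> \<le> card X * card X"
    unfolding fibre using r_le by (intro mult_right_mono) auto
  finally show ?thesis
    by (simp add: power2_eq_square algebra_simps)
qed

lemma additive_energy_singleton: "additive_energy {x} = 1"
proof -
  have "{(p, q). p \<in> {x} \<times> {x} \<and> q \<in> {x} \<times> {x} \<and> fst p + snd p = fst q + snd q}
      = {((x, x), (x, x))}"
    by auto
  then show ?thesis
    unfolding additive_energy_def by simp
qed

section \<open>Freiman invariance of the energy\<close>

lemma freiman_iso_order_two:
  assumes iso: "freiman_iso h \<phi> D S" and "h \<ge> 2"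
    and mem: "a \<in> D" "b \<in> D" "c \<in> D" "e \<in> D"
  shows "a + b = c + e \<longleftrightarrow> \<phi> a + \<phi> b = \<phi> c + \<phi> e"
proof -
  \<comment> \<open>Both sides of the equation are padded to length \<open>h\<close> with copies of
    \<open>a\<close>. As \<open>h \<ge> 2\<close>, the four special indices are distinct.\<close>
  define x where
    "x i = (if i = 1 then a else if i = 2 then b else if i = h + 1 then c
            else if i = h + 2 then e else a)" for i
  obtain k where k: "h = Suc (Suc k)"
    using \<open>h \<ge> 2\<close> by (metis add_2_eq_Suc le_Suc_ex)
  \<comment> \<open>The map \<open>f\<close> is arbitrary so that the formula serves for the points
    themselves and for their images; the padding then cancels.\<close>
  have left: "(\<Sum>i=1..h. f (x i)) = f a + f b + (\<Sum>i=1..k. f a)"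
    for f :: "'a \<Rightarrow> 'c::ab_group_add"
  proof -
    have "{1..h} = insert 1 (insert 2 ((\<lambda>i. i + 2) ` {1..k}))"
      unfolding k image_add_atLeastAtMost' by auto
    moreover have "(\<Sum>i\<in>(\<lambda>i. i + 2) ` {1..k}. f (x i)) = (\<Sum>i=1..k. f a)"
      by (subst sum.reindex) (auto simp: x_def k inj_on_def intro!: sum.cong)
    ultimately show ?thesis
      by (simp add: x_def k image_iff add.assoc)
  qed
  have right: "(\<Sum>i=h+1..2*h. f (x i)) = f c + f e + (\<Sum>i=1..k. f a)"
    for f :: "'a \<Rightarrow> 'c::ab_group_add"
  proof -
    have "{h+1..2*h} = insert (h+1) (insert (h+2) ((\<lambda>i. i + (h + 2)) ` {1..k}))"
      unfolding k image_add_atLeastAtMost' by auto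
    moreover have "(\<Sum>i\<in>(\<lambda>i. i + (h + 2)) ` {1..k}. f (x i)) = (\<Sum>i=1..k. f a)"
      by (subst sum.reindex) (auto simp: x_def k inj_on_def intro!: sum.cong)
    ultimately show ?thesis
      by (simp add: x_def k image_iff add.assoc)
  qed
  have "\<forall>i\<in>{1..2*h}. x i \<in> D"
    using mem by (auto simp: x_def)
  with iso have "(\<Sum>i=1..h. x i) = (\<Sum>i=h+1..2*h. x i) \<longleftrightarrow>
      (\<Sum>i=1..h. \<phi> (x i)) = (\<Sum>i=h+1..2*h. \<phi> (x i))"
    unfolding freiman_iso_def by blast
  then show ?thesis
    unfolding left right left[of "\<lambda>y. y"] right[of "\<lambda>y. y"] by simp
qed

lemma freiman_iso_additive_energy:
  assumes iso: "freiman_iso h \<phi> D S" and "h \<ge> 2" and "Y \<subseteq> D"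
  shows "additive_energy (\<phi> ` Y) = additive_energy Y"
proof -
  have inj: "inj_on \<phi> Y"
    using iso \<open>Y \<subseteq> D\<close> by (auto simp: freiman_iso_def bij_betw_def intro: inj_on_subset)
  have iff: "a + b = c + e \<longleftrightarrow> \<phi> a + \<phi> b = \<phi> c + \<phi> e"
    if "a \<in> Y" "b \<in> Y" "c \<in> Y" "e \<in> Y" for a b c e
    using freiman_iso_order_two[OF iso \<open>h \<ge> 2\<close>] that \<open>Y \<subseteq> D\<close> by blast
  let ?\<Phi> = "map_prod (map_prod \<phi> \<phi>) (map_prod \<phi> \<phi>)"
  let ?Q = "\<lambda>X. {(p, q). p \<in> X \<times> X \<and> q \<in> X \<times> X \<and> fst p + snd p = fst q + snd q}"
  have "bij_betw ?\<Phi> (?Q Y) (?Q (\<phi> ` Y))"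
    unfolding bij_betw_def
  proof
    show "inj_on ?\<Phi> (?Q Y)"
      using inj by (auto simp: inj_on_def)
    show "?\<Phi> ` ?Q Y = ?Q (\<phi> ` Y)"
    proof
      show "?\<Phi> ` ?Q Y \<subseteq> ?Q (\<phi> ` Y)"
        using iff by auto
      show "?Q (\<phi> ` Y) \<subseteq> ?\<Phi> ` ?Q Y"
      proof
        fix z assume "z \<in> ?Q (\<phi> ` Y)"
        then obtain a b c e where z: "z = ((\<phi> a, \<phi> b), (\<phi> c, \<phi> e))"
          and m: "a \<in> Y" "b \<in> Y" "c \<in> Y" "e \<in> Y" and "\<phi> a + \<phi> b = \<phi> c + \<phi> e"
          by auto
        then have "((a, b), (c, e)) \<in> ?Q Y"
          using iff by auto
        moreover have "z = ?\<Phi> ((a, b), (c, e))"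
          by (simp add: z)
        ultimately show "z \<in> ?\<Phi> ` ?Q Y"
          by blast
      qed
    qed
  qed
  then show ?thesis
    unfolding additive_energy_def by (rule bij_betw_same_card[symmetric])
qed

section \<open>Sets with hereditarily large energy on a sphere\<close>

text \<open>With \<open>v = x + y\<close>, both sides equal
  \<open>2 * (x \<bullet> x + x \<bullet> y)\<close>. The equation on \<open>x\<close> involves only
  \<open>v\<close>, so all representations of \<open>v\<close> by points of one sphere centred at 0
  lie in one hyperplane.\<close>

lemma sphere_sum_hyperplane:
  fixes x y :: "'a::real_inner"
  assumes "norm x = norm y"
  shows "2 * ((x + y) \<bullet> x) = (x + y) \<bullet> (x + y)"
  using assms by (simp add: norm_eq algebra_simps inner_commute)

text \<open>The midpoints v/2 and w/2 lie in \<open>U\<close>. Testing each against the other's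
  equation gives v.w = v.v and w.v = w.w, so v - w has length 0.\<close>

lemma sphere_section_exceptional_unique:
  fixes U :: "'a::real_inner set"
  assumes U: "affine U"
    and mem: "x \<in> U" "y \<in> U" "x' \<in> U" "y' \<in> U"
    and *: "\<And>z. z \<in> U \<Longrightarrow> 2 * ((x + y) \<bullet> z) = (x + y) \<bullet> (x + y)"
    and **: "\<And>z. z \<in> U \<Longrightarrow> 2 * ((x' + y') \<bullet> z) = (x' + y') \<bullet> (x' + y')"
  shows "x + y = x' + y'"
proof -
  let ?v = "x + y" and ?w = "x' + y'"
  have mid: "(1/2) *\<^sub>R a + (1/2) *\<^sub>R b \<in> U" if "a \<in> U" "b \<in> U" for a b
    using U that by (auto simp: affine_def)
  have "?v \<bullet> ?w = ?v \<bullet> ?v"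
    using *[OF mid[OF mem(3,4)]] by (simp add: inner_add_right)
  moreover have "?w \<bullet> ?v = ?w \<bullet> ?w"
    using **[OF mid[OF mem(1,2)]] by (simp add: inner_add_right)
  ultimately have "(?v - ?w) \<bullet> (?v - ?w) = 0"
    by (simp add: inner_diff_left inner_diff_right inner_commute)
  then show ?thesis by simp
qed

lemma affine_sphere_section:
  fixes v :: "'a::euclidean_space"
  assumes "affine U"
  shows "affine (U \<inter> {z. 2 * (v \<bullet> z) = v \<bullet> v})"
proof -
  have "{z. 2 * (v \<bullet> z) = v \<bullet> v} = {z. v \<bullet> z = (v \<bullet> v) / 2}"
    by auto
  then show ?thesis
    by (metis assms affine_Int affine_hyperplane)
qed

text \<open>For \<open>v = 0\<close> the equation holds everywhere; the second assumption excludes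
  this case too, so antipodal pairs need no separate treatment.\<close>

lemma aff_dim_sphere_section_less:
  fixes U :: "'a::euclidean_space set"
  assumes "affine U" and "\<not> U \<subseteq> {z. 2 * (v \<bullet> z) = v \<bullet> v}"
  shows "aff_dim (U \<inter> {z. 2 * (v \<bullet> z) = v \<bullet> v}) < aff_dim U"
proof (rule aff_dim_psubset)
  show "affine hull (U \<inter> {z. 2 * (v \<bullet> z) = v \<bullet> v}) \<subset> affine hull U"
    using assms affine_sphere_section[OF assms(1), of v]
    by (simp add: hull_same psubset_eq) blast
qed

text \<open>Two distinct points cannot both lie in a proper section of a line, so their sum must be
  exceptional. Three points would yield two different exceptional sums.\<close>

lemma card_sphere_Int_line:
  fixes X :: "'a::euclidean_space set"
  assumes U: "affine U" "aff_dim U \<le> 1" and "X \<subseteq> U"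
    and norm: "\<And>x. x \<in> X \<Longrightarrow> norm x = \<rho>"
  shows "card X \<le> 2"
proof (rule ccontr)
  assume "\<not> card X \<le> 2"
  then have "3 \<le> card X" by simp
  then obtain T where "T \<subseteq> X" "card T = 3"
    by (rule obtain_subset_with_card_n)
  then obtain a b c where abc: "a \<in> X" "b \<in> X" "c \<in> X" "a \<noteq> b" "a \<noteq> c" "b \<noteq> c"
    by (auto simp: card_3_iff)
  have key: "U \<subseteq> {z. 2 * ((x + y) \<bullet> z) = (x + y) \<bullet> (x + y)}"
    if "x \<in> X" "y \<in> X" "x \<noteq> y" for x y
  proof (rule ccontr)
    let ?V = "U \<inter> {z. 2 * ((x + y) \<bullet> z) = (x + y) \<bullet> (x + y)}"
    assume "\<not> ?thesis"
    then have "aff_dim ?V < 1"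
      using aff_dim_sphere_section_less[OF U(1)] U(2) by force
    moreover have "{x, y} \<subseteq> ?V"
      using that norm \<open>X \<subseteq> U\<close> sphere_sum_hyperplane[of x y] sphere_sum_hyperplane[of y x]
      by (auto simp: add.commute)
    then have "aff_dim {x, y} \<le> aff_dim ?V"
      by (rule aff_dim_subset)
    ultimately show False
      using \<open>x \<noteq> y\<close> by (simp add: aff_dim_2)
  qed
  have "a + b = a + c"
    using abc \<open>X \<subseteq> U\<close> key[of a b] key[of a c]
    by (intro sphere_section_exceptional_unique[OF U(1)]) auto
  with abc show False by simp
qed

text \<open>The bound is B_k = 2 M^(1 - 1/2^k) raised to the power 2^k, which avoids fractional
  exponents. It solves B_(k+1)^2 = 2 M B_k with B_0 = 2, the bound for a line. The energy hypothesis
  covers all subsets because the induction passes to the sets of summands of a fixed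
  \<open>v\<close>.\<close>

lemma card_sphere_hereditary_energy:
  fixes X U :: "'a::euclidean_space set"
  assumes "finite X" "X \<noteq> {}" "X \<subseteq> U" "affine U" "aff_dim U \<le> int k + 1"
    and "\<And>x. x \<in> X \<Longrightarrow> norm x = \<rho>"
    and "\<And>Y. Y \<subseteq> X \<Longrightarrow> real (card Y) ^ 4 \<le> M * real (additive_energy Y)"
  shows "real (card X) ^ (2 ^ k) \<le> 2 ^ (2 ^ k) * M ^ (2 ^ k - 1)"
  using assms
proof (induction k arbitrary: X U)
  case 0
  then show ?case
    using card_sphere_Int_line[of U X \<rho>] by auto
next
  case (Suc k X U)
  \<comment> \<open>A singleton has energy 1, so the hypothesis for it reads
    \<open>1 \<le> M\<close>.\<close>
  have M: "1 \<le> M"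
  proof -
    obtain x where "x \<in> X" using Suc.prems(2) by blast
    then show ?thesis
      using Suc.prems(7)[of "{x}"] by (simp add: additive_energy_singleton)
  qed
  let ?H = "\<lambda>v. {z. 2 * (v \<bullet> z) = v \<bullet> v}"
  let ?R = "\<lambda>v. {x \<in> X. v - x \<in> X}"
  \<comment> \<open>For non-exceptional \<open>v\<close> the summands lie in a section of dimension
    smaller by at least one, where the induction hypothesis applies.\<close>
  have bound: "real (card (?R v)) ^ (2 ^ k) \<le> 2 ^ (2 ^ k) * M ^ (2 ^ k - 1)"
    if "?R v \<noteq> {}" "\<not> U \<subseteq> ?H v" for v
  proof (rule Suc.IH[of _ "U \<inter> ?H v"])
    have "x \<in> ?H v" if "x \<in> ?R v" for x
      using sphere_sum_hyperplane[of x "v - x"] that Suc.prems(6) by simp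
    then show "?R v \<subseteq> U \<inter> ?H v"
      using Suc.prems(3) by blast
    show "aff_dim (U \<inter> ?H v) \<le> int k + 1"
      using aff_dim_sphere_section_less[OF Suc.prems(4) that(2)] Suc.prems(5) by simp
    show "affine (U \<inter> ?H v)"
      by (rule affine_sphere_section[OF Suc.prems(4)])
    show "real (card Y) ^ 4 \<le> M * real (additive_energy Y)" if "Y \<subseteq> ?R v" for Y
      using that by (intro Suc.prems(7)) blast
  qed (use Suc.prems(1,6) that in auto)
  \<comment> \<open>\<open>v0\<close> is the exceptional sum if there is one, and arbitrary
    otherwise.\<close>
  obtain v0 where v0: "\<And>v. v \<noteq> v0 \<Longrightarrow> ?R v \<noteq> {} \<Longrightarrow> \<not> U \<subseteq> ?H v"
  proof (cases "\<exists>v. ?R v \<noteq> {} \<and> U \<subseteq> ?H v")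
    case True
    then obtain w x where w: "x \<in> X" "w - x \<in> X" "U \<subseteq> ?H w" by blast
    show ?thesis
    proof (rule that[of w], rule notI)
      fix v assume "v \<noteq> w" "?R v \<noteq> {}" "U \<subseteq> ?H v"
      moreover from this obtain y where y: "y \<in> X" "v - y \<in> X" by blast
      ultimately have "y + (v - y) = x + (w - x)"
        using w Suc.prems(3) by (intro sphere_section_exceptional_unique[OF Suc.prems(4)]) auto
      with \<open>v \<noteq> w\<close> show False by simp
    qed
  qed blast
  \<comment> \<open>Inserting 1 keeps the maximum \<open>N\<close> defined and at least 1, so that
    \<open>N + 1 \<le> 2 * N\<close> below; if \<open>N = 1\<close>, its bound follows from
    \<open>1 \<le> M\<close>.\<close>
  define B where "B = insert 1 ((\<lambda>v. card (?R v)) ` {v. v \<noteq> v0 \<and> ?R v \<noteq> {}})"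
  have "B \<subseteq> {..Suc (card X)}"
    unfolding B_def using Suc.prems(1) by (auto intro!: le_SucI card_mono)
  then have finB: "finite B"
    using finite_subset by blast
  define N where "N = Max B"
  have "N \<in> B" "1 \<le> N"
    unfolding N_def by (rule Max_in[OF finB], simp add: B_def, rule Max_ge[OF finB], simp add: B_def)
  have rN: "card (?R v) \<le> N" if "v \<noteq> v0" for v
  proof (cases "?R v = {}")
    case False
    then show ?thesis
      unfolding N_def using that by (intro Max_ge[OF finB]) (auto simp: B_def)
  qed (simp only: card.empty)
  have N_bound: "real N ^ (2 ^ k) \<le> 2 ^ (2 ^ k) * M ^ (2 ^ k - 1)"
  proof -
    consider "N = 1" | v where "v \<noteq> v0" "?R v \<noteq> {}" "N = card (?R v)"
      using \<open>N \<in> B\<close> unfolding B_def by blast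
    then show ?thesis
    proof cases
      case 1
      have "1 * 1 \<le> (2::real) ^ (2 ^ k) * M ^ (2 ^ k - 1)"
        using M by (intro mult_mono one_le_power) auto
      then show ?thesis by (simp add: 1)
    next
      case 2
      show ?thesis
        unfolding 2(3) by (rule bound[OF 2(2) v0[OF 2(1,2)]])
    qed
  qed
  have "additive_energy X \<le> (card X)\<^sup>2 * (N + 1)"
    using additive_energy_le[OF Suc.prems(1)] rN by blast
  also have "\<dots> \<le> (card X)\<^sup>2 * (2 * N)"
    using \<open>1 \<le> N\<close> by (intro mult_left_mono) auto
  finally have "real (additive_energy X) \<le> real ((card X)\<^sup>2 * (2 * N))"
    by (rule of_nat_mono)
  then have "M * real (additive_energy X) \<le> M * ((real (card X))\<^sup>2 * (2 * real N))"
    using M by (intro mult_left_mono) auto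
  then have "real (card X) ^ 4 \<le> M * ((real (card X))\<^sup>2 * (2 * real N))"
    using Suc.prems(7)[of X] by simp
  \<comment> \<open>Cancelling the square of \<open>card X\<close> leaves the recursion card X ^ 2
    <= 2 M N.\<close>
  then have "(real (card X))\<^sup>2 * (real (card X))\<^sup>2 \<le> (real (card X))\<^sup>2 * (M * (2 * real N))"
    by (simp add: mult_ac flip: power_add)
  moreover have "(real (card X))\<^sup>2 > 0"
    using Suc.prems(1,2) by (simp add: card_gt_0_iff)
  ultimately have sq: "(real (card X))\<^sup>2 \<le> M * (2 * real N)"
    by (rule mult_left_le_imp_le)
  have "real (card X) ^ (2 ^ Suc k) = ((real (card X))\<^sup>2) ^ (2 ^ k)"
    by (simp only: power_Suc power_mult)
  also have "\<dots> \<le> (M * (2 * real N)) ^ (2 ^ k)"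
    using sq by (intro power_mono) auto
  also have "\<dots> = M ^ (2 ^ k) * 2 ^ (2 ^ k) * real N ^ (2 ^ k)"
    by (simp only: power_mult_distrib mult.assoc)
  also have "\<dots> \<le> M ^ (2 ^ k) * 2 ^ (2 ^ k) * (2 ^ (2 ^ k) * M ^ (2 ^ k - 1))"
    using N_bound M by (intro mult_left_mono) auto
  also have "\<dots> = 2 ^ (2 ^ k + 2 ^ k) * M ^ (2 ^ k + (2 ^ k - 1))"
    by (simp only: power_add mult_ac)
  also have "2 ^ k + (2 ^ k - 1) = 2 ^ Suc k - (1::nat)"
    by (simp add: mult_2)
  also have "2 ^ k + 2 ^ k = (2::nat) ^ Suc k"
    by simp
  finally show ?case .
qed

section \<open>Exponential sums on the torus\<close>

abbreviation torus_character :: "nat \<Rightarrow> (nat \<Rightarrow> int) \<Rightarrow> (nat \<Rightarrow> real) \<Rightarrow> complex" where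
  "torus_character m a t \<equiv> add_char (\<Sum>i<m. of_int (a i) * t i)"

lemma add_char_add: "add_char (x + y) = add_char x * add_char y"
  by (simp add: add_char_def exp_add algebra_simps)

lemma add_char_cnj: "cnj (add_char x) = add_char (- x)"
  by (simp add: add_char_def exp_cnj)

lemma add_char_sum: "finite I \<Longrightarrow> add_char (\<Sum>i\<in>I. f i) = (\<Prod>i\<in>I. add_char (f i))"
  by (induction I rule: finite_induct) (auto simp: add_char_add, simp add: add_char_def)

lemma torus_character_add:
  "torus_character m (a + b) t = torus_character m a t * torus_character m b t"
  by (simp add: algebra_simps sum.distrib flip: add_char_add)

lemma torus_character_cnj: "cnj (torus_character m a t) = torus_character m (- a) t"
  by (simp add: add_char_cnj sum_negf)

section \<open>Orthogonality of characters and moments of exponential sums\<close>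

lemma integral_add_char_unit_interval:
  "has_bochner_integral (restrict_space lborel {0..<1::real}) (\<lambda>x. add_char (of_int n * x))
     (if n = 0 then 1 else 0)"
proof -
  let ?f = "\<lambda>x. add_char (of_int n * x)"
  have cont: "continuous_on A ?f" for A
    unfolding add_char_def by (intro continuous_intros)
  let ?F = "\<lambda>x. if n = 0 then of_real x else add_char (of_int n * x) / (2 * pi * \<i> * of_int n)"
  have deriv: "(?F has_vector_derivative ?f x) (at x within {0..1})" for x
  proof (cases "n = 0")
    case True
    then show ?thesis
      by (auto simp: add_char_def intro!: derivative_eq_intros has_vector_derivative_of_real)
  next
    case False
    have "((\<lambda>x. exp (2 * pi * \<i> * of_int n * x) / (2 * pi * \<i> * of_int n)) has_field_derivative
        exp (2 * pi * \<i> * of_int n * of_real x)) (at (of_real x))"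
      using False by (auto intro!: derivative_eq_intros)
    from has_vector_derivative_real_field[OF this, of "{0..1}"] show ?thesis
      using False by (simp add: add_char_def mult.assoc)
  qed
  have "add_char (of_int n) = 1"
    using exp_integer_2pi[of "of_int n"] by (simp add: add_char_def mult_ac)
  moreover have "add_char 0 = 1"
    by (simp add: add_char_def)
  ultimately have "?F 1 - ?F 0 = (if n = 0 then 1 else 0)"
    by simp
  moreover have "has_bochner_integral lborel (\<lambda>x. indicator {0..1} x *\<^sub>R ?f x) (?F 1 - ?F 0)"
    by (rule has_bochner_integral_FTC_Icc) (use deriv cont in auto)
  ultimately have "has_bochner_integral lborel (\<lambda>x. indicator {0..1} x *\<^sub>R ?f x)
      (if n = 0 then 1 else 0)"
    by simp
  \<comment> \<open>The fundamental theorem gives the closed interval; the endpoint 1 is a null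
    set.\<close>
  moreover have "AE x in lborel. indicator {0..1} x *\<^sub>R ?f x = indicator {0..<1} x *\<^sub>R ?f x"
    using AE_lborel_singleton[of "1::real"] by eventually_elim (auto simp: indicator_def)
  moreover have "?f \<in> borel_measurable borel"
    using cont by (rule borel_measurable_continuous_onI)
  ultimately have "has_bochner_integral lborel (\<lambda>x. indicator {0..<1} x *\<^sub>R ?f x)
      (if n = 0 then 1 else 0)"
    by (subst (asm) has_bochner_integral_cong_AE) auto
  then show ?thesis
    by (simp add: has_bochner_integral_restrict_space)
qed

lemma product_sigma_finite_unit_interval:
  "product_sigma_finite (\<lambda>i::nat. restrict_space lborel {0..<1::real})"
  unfolding product_sigma_finite_def
  by (auto intro!: sigma_finite_measure_restrict_space lborel.sigma_finite_measure_axioms)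

lemma integral_torus_character:
  assumes "a \<in> int_lattice m"
  shows "has_bochner_integral (torus_measure m) (torus_character m a) (if a = 0 then 1 else 0)"
proof -
  interpret product_sigma_finite "\<lambda>i::nat. restrict_space lborel {0..<1::real}"
    by (rule product_sigma_finite_unit_interval)
  have prod: "torus_character m a = (\<lambda>t. \<Prod>i<m. add_char (of_int (a i) * t i))"
    by (simp add: add_char_sum)
  have int: "integrable (restrict_space lborel {0..<1}) (\<lambda>x. add_char (of_int (a i) * x))" for i
    using integral_add_char_unit_interval by (rule integrable.intros)
  have "integral\<^sup>L (torus_measure m) (torus_character m a) = (\<Prod>i<m. if a i = 0 then 1 else 0)"
    unfolding torus_measure_def prod
    by (subst product_integral_prod)
       (use int in \<open>auto simp: has_bochner_integral_integral_eq[OF integral_add_char_unit_interval]\<close>)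
  also have "\<dots> = (if \<forall>i<m. a i = 0 then 1 else 0)"
    by (auto simp: prod_zero_iff)
  \<comment> \<open>Coordinates from \<open>m\<close> on vanish by membership in the lattice, so the
    first \<open>m\<close> decide.\<close>
  also have "(\<forall>i<m. a i = 0) \<longleftrightarrow> a = 0"
    using assms by (auto simp: int_lattice_def fun_eq_iff) (metis not_le)
  finally show ?thesis
    unfolding has_bochner_integral_iff torus_measure_def prod
    using product_integrable_prod[OF _ int, of "{..<m}"] by simp
qed

lemma int_lattice_add: "a \<in> int_lattice m \<Longrightarrow> b \<in> int_lattice m \<Longrightarrow> a + b \<in> int_lattice m"
  and int_lattice_diff: "a \<in> int_lattice m \<Longrightarrow> b \<in> int_lattice m \<Longrightarrow> a - b \<in> int_lattice m"
  by (auto simp: int_lattice_def)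

text \<open>Expanding the product gives the characters of \<open>u i - v j\<close>, and
  orthogonality keeps the coincidences. Indexed families allow repeated frequencies, as needed for
  sums of pairs.\<close>

lemma integral_exponential_sum_inner:
  assumes "finite I" "finite J" "u ` I \<subseteq> int_lattice m" "v ` J \<subseteq> int_lattice m"
  shows "has_bochner_integral (torus_measure m)
    (\<lambda>t. (\<Sum>i\<in>I. torus_character m (u i) t) * cnj (\<Sum>j\<in>J. torus_character m (v j) t))
    (of_nat (card {(i, j). i \<in> I \<and> j \<in> J \<and> u i = v j}))"
proof -
  have "has_bochner_integral (torus_measure m)
      (\<lambda>t. \<Sum>i\<in>I. \<Sum>j\<in>J. torus_character m (u i - v j) t)
      (\<Sum>i\<in>I. \<Sum>j\<in>J. if u i - v j = 0 then 1 else 0)"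
    using assms
    by (intro has_bochner_integral_sum integral_torus_character int_lattice_diff) auto
  moreover have "(\<Sum>i\<in>I. \<Sum>j\<in>J. if u i - v j = 0 then 1 else 0)
      = (of_nat (card {(i, j). i \<in> I \<and> j \<in> J \<and> u i = v j}) :: complex)"
  proof -
    have "{(i, j). i \<in> I \<and> j \<in> J \<and> u i = v j} = (SIGMA i : I. {j \<in> J. u i = v j})"
      by auto
    then show ?thesis
      using assms(1,2) by (simp add: card_SigmaI sum.If_cases Int_def)
  qed
  moreover have "(\<Sum>i\<in>I. \<Sum>j\<in>J. torus_character m (u i - v j) t)
      = (\<Sum>i\<in>I. torus_character m (u i) t) * cnj (\<Sum>j\<in>J. torus_character m (v j) t)" for t
  proof -
    have "torus_character m (u i - v j) t
        = torus_character m (u i) t * cnj (torus_character m (v j) t)" for i j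
      unfolding torus_character_cnj torus_character_add[symmetric] by simp
    then show ?thesis
      by (simp add: sum_product)
  qed
  ultimately show ?thesis
    by simp
qed

lemma integral_exponential_sum_norm_sq:
  assumes "finite I" "u ` I \<subseteq> int_lattice m"
  shows "has_bochner_integral (torus_measure m)
    (\<lambda>t. (norm (\<Sum>i\<in>I. torus_character m (u i) t))\<^sup>2)
    (real (card {(i, j). i \<in> I \<and> j \<in> I \<and> u i = u j}))"
proof -
  have "has_bochner_integral (torus_measure m)
    (\<lambda>t. Re ((\<Sum>i\<in>I. torus_character m (u i) t) * cnj (\<Sum>j\<in>I. torus_character m (u j) t)))
    (Re (of_nat (card {(i, j). i \<in> I \<and> j \<in> I \<and> u i = u j})))"
    by (intro has_bochner_integral_Re integral_exponential_sum_inner assms)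
  moreover have "Re (z * cnj z) = (norm z)\<^sup>2" for z
    by (metis Re_complex_of_real complex_norm_square)
  ultimately show ?thesis
    by (simp only: complex_Re_of_nat)
qed

section \<open>From the Fourier L1 norm to the energy inequality\<close>

lemma integral_Cauchy_Schwarz:
  fixes p q :: "'a \<Rightarrow> real"
  assumes p: "integrable M (\<lambda>x. (p x)\<^sup>2)" and q: "integrable M (\<lambda>x. (q x)\<^sup>2)"
    and pq: "integrable M (\<lambda>x. p x * q x)"
  shows "(LINT x|M. p x * q x)\<^sup>2 \<le> (LINT x|M. (p x)\<^sup>2) * (LINT x|M. (q x)\<^sup>2)"
proof -
  define P Q B where "P = (LINT x|M. (p x)\<^sup>2)" and "Q = (LINT x|M. (q x)\<^sup>2)"
    and "B = (LINT x|M. p x * q x)"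
  have quad: "0 \<le> s\<^sup>2 * P - 2 * s * r * B + r\<^sup>2 * Q" for s r
  proof -
    have "(LINT x|M. (s * p x - r * q x)\<^sup>2)
        = (LINT x|M. s\<^sup>2 * (p x)\<^sup>2 - 2 * s * r * (p x * q x) + r\<^sup>2 * (q x)\<^sup>2)"
      by (intro Bochner_Integration.integral_cong) (auto simp: power2_eq_square algebra_simps)
    also have "\<dots> = s\<^sup>2 * P - 2 * s * r * B + r\<^sup>2 * Q"
      using p q pq by (simp add: P_def Q_def B_def)
    finally show ?thesis
      using Bochner_Integration.integral_nonneg[of M "\<lambda>x. (s * p x - r * q x)\<^sup>2"] by simp
  qed
  have "0 \<le> P" "0 \<le> Q"
    unfolding P_def Q_def by auto
  have "B\<^sup>2 \<le> P * Q"
  proof (cases "P = 0")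
    case True
    have "B = 0"
    proof (rule ccontr)
      assume "B \<noteq> 0"
      then show False
        \<comment> \<open>At these values the quadratic form equals (Q + 1) times -1 plus Q, that is
          -1.\<close>
        using quad[of "(Q + 1) / (2 * B)" 1] True by simp
    qed
    then show ?thesis using True by simp
  next
    case False
    \<comment> \<open>The minimising direction is \<open>s = B\<close>, \<open>r = P\<close>, where
      the form factors.\<close>
    have "0 \<le> P * (P * Q - B\<^sup>2)"
      using quad[of B P] by (simp add: power2_eq_square algebra_simps)
    then show ?thesis
      using False \<open>0 \<le> P\<close> by (simp add: zero_le_mult_iff)
  qed
  then show ?thesis
    by (simp add: P_def Q_def B_def)
qed

text \<open>With \<open>f\<close>, \<open>g\<close> the sums over \<open>A\<close>,
  \<open>Y\<close>, orthogonality gives card Y <= I, the integral of |f||g|. Then I^2 <= ||A|| L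
  with L the integral of |f||g|^2, and L^2 is at most the integral of |f|^2, which is card A, times
  that of |g|^4, the energy of \<open>Y\<close>.\<close>

lemma card_power4_le_L1_norm_energy:
  assumes "A \<subseteq> int_lattice m" "finite A" "Y \<subseteq> A"
  shows "real (card Y) ^ 4
    \<le> (fourier_L1_norm m A)\<^sup>2 * real (card A) * real (additive_energy Y)"
proof -
  let ?M = "torus_measure m"
  define f g where "f t = (\<Sum>a\<in>A. torus_character m a t)"
    and "g t = (\<Sum>a\<in>Y. torus_character m a t)" for t
  have finY: "finite Y" and Y: "Y \<subseteq> int_lattice m"
    using assms finite_subset by auto
  have g2: "(g t)\<^sup>2 = (\<Sum>p\<in>Y \<times> Y. torus_character m (fst p + snd p) t)" for t
    unfolding g_def power2_eq_square torus_character_add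
    by (simp add: sum_product sum.cartesian_product case_prod_beta)
  have char_int: "integrable ?M (torus_character m a)" if "a \<in> int_lattice m" for a
    using integral_torus_character[OF that] by (rule integrable.intros)
  have f_int: "integrable ?M (\<lambda>t. norm (f t))"
    unfolding f_def using assms(1)
    by (intro integrable_norm Bochner_Integration.integrable_sum char_int) auto
  have f2: "has_bochner_integral ?M (\<lambda>t. (norm (f t))\<^sup>2) (real (card A))"
  proof -
    have "{(i, j). i \<in> A \<and> j \<in> A \<and> i = j} = (\<lambda>x. (x, x)) ` A"
      by auto
    then have "card {(i, j). i \<in> A \<and> j \<in> A \<and> i = j} = card A"
      by (simp add: card_image inj_on_def)
    then show ?thesis
      using integral_exponential_sum_norm_sq[of A "\<lambda>a. a" m] assms by (simp add: f_def)
  qed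
  have g4: "has_bochner_integral ?M (\<lambda>t. ((norm (g t))\<^sup>2)\<^sup>2) (real (additive_energy Y))"
  proof -
    have "has_bochner_integral ?M (\<lambda>t. (norm ((g t)\<^sup>2))\<^sup>2) (real (additive_energy Y))"
      unfolding g2 additive_energy_def
      by (rule integral_exponential_sum_norm_sq, use finY in simp, rule image_subsetI)
        (use Y in \<open>auto simp del: plus_fun_apply intro!: int_lattice_add\<close>)
    then show ?thesis by (simp add: norm_power)
  qed
  have fg: "has_bochner_integral ?M (\<lambda>t. f t * cnj (g t)) (of_nat (card Y))"
  proof -
    have "{(i, j). i \<in> A \<and> j \<in> Y \<and> i = j} = (\<lambda>x. (x, x)) ` Y"
      using assms(3) by auto
    then have "card {(i, j). i \<in> A \<and> j \<in> Y \<and> i = j} = card Y"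
      by (simp add: card_image inj_on_def)
    then show ?thesis
      using integral_exponential_sum_inner[of A Y "\<lambda>a. a" m "\<lambda>a. a"] assms finY Y
      by (simp add: f_def g_def)
  qed
  have fg_int: "integrable ?M (\<lambda>t. norm (f t) * norm (g t))"
    using integrable_norm[OF integrable.intros[OF fg]] by (simp add: norm_mult)
  have fg2_int: "integrable ?M (\<lambda>t. norm (f t) * (norm (g t))\<^sup>2)"
  proof -
    \<comment> \<open>f g^2 is again a finite sum of characters, hence integrable.\<close>
    have "integrable ?M (\<lambda>t. \<Sum>a\<in>A. \<Sum>p\<in>Y \<times> Y. torus_character m (a + (fst p + snd p)) t)"
      using assms(1) Y
      by (intro Bochner_Integration.integrable_sum char_int)
        (auto simp del: plus_fun_apply intro!: int_lattice_add)
    moreover have "(\<Sum>a\<in>A. \<Sum>p\<in>Y \<times> Y. torus_character m (a + (fst p + snd p)) t)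
        = f t * (g t)\<^sup>2" for t
      unfolding g2 f_def sum_product
      by (intro sum.cong refl) (rule torus_character_add)
    ultimately have "integrable ?M (\<lambda>t. norm (f t * (g t)\<^sup>2))"
      by (simp add: integrable_norm)
    then show ?thesis
      by (simp add: norm_mult norm_power)
  qed
  define I where "I = (LINT t|?M. norm (f t) * norm (g t))"
  define L where "L = (LINT t|?M. norm (f t) * (norm (g t))\<^sup>2)"
  have L1: "fourier_L1_norm m A = (LINT t|?M. norm (f t))"
    by (simp add: fourier_L1_norm_def f_def)
  have card_le: "real (card Y) \<le> I"
    using integral_norm_bound[of ?M "\<lambda>t. f t * cnj (g t)"] has_bochner_integral_integral_eq[OF fg]
    by (simp add: I_def norm_mult)
  have first: "I\<^sup>2 \<le> fourier_L1_norm m A * L"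
  proof -
    \<comment> \<open>Cauchy-Schwarz is applied to |f|^(1/2) and |f|^(1/2) |g|, so that one factor
      is the L1 norm.\<close>
    have sqrt: "sqrt (norm z) * (sqrt (norm z) * w) = norm z * w" for z :: complex and w :: real
      by (simp flip: mult.assoc)
    then show ?thesis
      using integral_Cauchy_Schwarz[of ?M "\<lambda>t. sqrt (norm (f t))"
          "\<lambda>t. sqrt (norm (f t)) * norm (g t)"] f_int fg_int fg2_int
      by (simp add: I_def L_def L1 power_mult_distrib sqrt)
  qed
  have second: "L\<^sup>2 \<le> real (card A) * real (additive_energy Y)"
    using integral_Cauchy_Schwarz[of ?M "\<lambda>t. norm (f t)" "\<lambda>t. (norm (g t))\<^sup>2"]
      integrable.intros[OF f2] integrable.intros[OF g4] fg2_int
      has_bochner_integral_integral_eq[OF f2] has_bochner_integral_integral_eq[OF g4]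
    by (simp add: L_def)
  have "real (card Y) ^ 4 \<le> (I\<^sup>2)\<^sup>2"
    using power_mono[OF card_le, of 4] by simp
  also have "\<dots> \<le> (fourier_L1_norm m A * L)\<^sup>2"
    using first by (intro power_mono) auto
  also have "\<dots> \<le> (fourier_L1_norm m A)\<^sup>2 * (real (card A) * real (additive_energy Y))"
    using second by (simp add: power_mult_distrib mult_left_mono)
  finally show ?thesis
    by (simp add: mult.assoc)
qed

section \<open>Spherical Freiman models\<close>

text \<open>Each subset of \<open>S\<close> is the image of a subset of \<open>D\<close>, hence of
  \<open>A\<close>, with the same size and energy. The sphere bound thus applies with
  \<open>U\<close> the whole space and k = d - 1, where 2^k is
  \<open>t_exp CARD('d) + 1\<close>.\<close>

lemma card_spherical_model:
  fixes S :: "(real ^ 'd::finite) set"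
  assumes A: "A \<subseteq> int_lattice m" "finite A" and D: "D \<subseteq> A" "D \<noteq> {}"
    and "h \<ge> 2" and S: "S \<subseteq> lattice_sphere R" and iso: "freiman_iso h \<phi> D S"
  shows "real (card D) ^ (t_exp CARD('d) + 1)
    \<le> 2 ^ (t_exp CARD('d) + 1) * ((fourier_L1_norm m A)\<^sup>2 * real (card A)) ^ t_exp CARD('d)"
proof -
  let ?M = "(fourier_L1_norm m A)\<^sup>2 * real (card A)"
  have bij: "bij_betw \<phi> D S"
    using iso by (simp add: freiman_iso_def)
  have finD: "finite D"
    using A D finite_subset by blast
  have "real (card S) ^ (2 ^ (CARD('d) - 1))
      \<le> 2 ^ (2 ^ (CARD('d) - 1)) * ?M ^ (2 ^ (CARD('d) - 1) - 1)"
  proof (rule card_sphere_hereditary_energy[where U = UNIV and \<rho> = "real R"])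
    show "finite S" "S \<noteq> {}"
      using bij finD D bij_betw_finite[OF bij] by (auto simp: bij_betw_def)
    show "aff_dim (UNIV :: (real ^ 'd) set) \<le> int (CARD('d) - 1) + 1"
      by (simp add: of_nat_diff)
    show "norm x = real R" if "x \<in> S" for x
      using S that by (auto simp: lattice_sphere_def)
  next
    fix Y assume "Y \<subseteq> S"
    then obtain Z where Z: "Z \<subseteq> D" "Y = \<phi> ` Z"
      using bij by (metis bij_betw_imp_surj_on subset_image_iff)
    have "card Y = card Z"
      unfolding Z(2) using bij Z(1) by (intro card_image) (auto simp: bij_betw_def intro: inj_on_subset)
    moreover have "additive_energy Y = additive_energy Z"
      unfolding Z(2) by (rule freiman_iso_additive_energy[OF iso \<open>h \<ge> 2\<close> Z(1)])
    moreover have "Z \<subseteq> A"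
      using Z(1) D(1) by blast
    ultimately show "real (card Y) ^ 4 \<le> ?M * real (additive_energy Y)"
      using card_power4_le_L1_norm_energy[OF A] by simp
  qed auto
  moreover have "card S = card D"
    using bij by (simp add: bij_betw_same_card)
  moreover have "t_exp CARD('d) + 1 = 2 ^ (CARD('d) - 1)"
    by (simp add: t_exp_def)
  ultimately show ?thesis
    by (simp add: t_exp_def)
qed

text \<open>For a = |A|, k = |D|, L = ||A|| this takes 2t-th roots in the size bound: the power 2t
  of the claimed expression without 1/2 is k^(t+1) / a^t.\<close>

lemma L1_norm_lower_bound:
  fixes a k L :: real
  assumes "0 < k" "0 < a" "0 \<le> L" "1 \<le> t"
    and le: "k ^ (t + 1) \<le> 2 ^ (t + 1) * (L\<^sup>2 * a) ^ t"
  shows "1/2 * a powr (1 / (2 * real t)) * (k / a) powr ((real t + 1) / (2 * real t)) \<le> L"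
proof -
  let ?x = "a powr (1 / (2 * real t)) * (k / a) powr ((real t + 1) / (2 * real t))"
  have "?x ^ (2 * t) = a powr (1 / (2 * real t) * real (2 * t))
      * (k / a) powr ((real t + 1) / (2 * real t) * real (2 * t))"
    using assms by (simp add: power_mult_distrib powr_powr flip: powr_realpow)
  also have "\<dots> = a powr 1 * (k / a) powr (real (t + 1))"
    using assms by (simp add: add.commute)
  also have "\<dots> = a * (k / a) ^ (t + 1)"
    using assms by (simp only: powr_realpow divide_pos_pos powr_one)
  also have "\<dots> = k ^ (t + 1) / a ^ t"
    using assms by (simp add: power_divide)
  also have "\<dots> \<le> 2 ^ (t + 1) * L ^ (2 * t)"
    using le assms by (simp add: divide_le_eq power_mult_distrib power_mult mult.assoc)
  \<comment> \<open>Since \<open>1 \<le> t\<close>, t + 1 <= 2t; enlarging the exponent gives the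
    constant 1/2 for every dimension.\<close>
  also have "\<dots> \<le> 2 ^ (2 * t) * L ^ (2 * t)"
    using assms by (intro mult_right_mono power_increasing) auto
  also have "\<dots> = (2 * L) ^ (2 * t)"
    by (simp add: power_mult_distrib)
  finally have pow: "?x ^ (2 * t) \<le> (2 * L) ^ (2 * t)" .
  have "?x \<le> 2 * L"
  proof (rule power_le_imp_le_base)
    show "?x ^ Suc (2 * t - 1) \<le> (2 * L) ^ Suc (2 * t - 1)"
      using pow \<open>1 \<le> t\<close> by (simp only: Suc_diff_1 mult_pos_pos zero_less_numeral
          less_le_trans[OF zero_less_one])
    show "0 \<le> 2 * L"
      using \<open>0 \<le> L\<close> by simp
  qed
  then show ?thesis
    by simp
qed

theorem theorem6:
  fixes d :: nat
  assumes "d = CARD('d::finite)" and "d \<ge> 2"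
  shows "\<exists>C>0. \<exists>c>0. \<forall>(m::nat) (A :: (nat \<Rightarrow> int) set) D (S :: (real ^ 'd) set) h R \<phi>.
    m \<ge> 1 \<and> A \<subseteq> int_lattice m \<and> finite A \<and> A \<noteq> {} \<and>
    D \<subseteq> A \<and> D \<noteq> {} \<and> h \<ge> 2 \<and> R > 0 \<and> S \<subseteq> lattice_sphere R \<and> freiman_iso h \<phi> D S \<longrightarrow>
    (let \<alpha> = real (card D) / real (card A); t = t_exp d in
      (\<forall>\<eta>. 0 < \<eta> \<and> \<eta> < 1 \<longrightarrow>
        (\<exists>(J::nat) (P :: nat \<Rightarrow> (real ^ 'd) set).
          (\<forall>j\<in>{1..J}. affine (P j) \<and> P j \<noteq> {} \<and> aff_dim (P j) \<le> 1) \<and>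
          real (card (S \<inter> (\<Union>j\<in>{1..J}. P j))) \<ge> (1 - \<eta>) * real (card S) \<and>
          real J \<le> C * (1 / \<eta>\<^sup>2 * ((fourier_L1_norm m A)\<^sup>2 / \<alpha>)) ^ t)) \<and>
      fourier_L1_norm m A \<ge>
        c * real (card A) powr (1 / (2 * real t)) * \<alpha> powr ((real t + 1) / (2 * real t)))"
proof -
  let ?t = "t_exp d"
  have t: "1 \<le> ?t"
  proof -
    have "(2::nat) ^ 1 \<le> 2 ^ (d - 1)"
      using assms(2) by (intro power_increasing) auto
    then show ?thesis by (simp add: t_exp_def)
  qed
  have main: "(\<forall>\<eta>. 0 < \<eta> \<and> \<eta> < 1 \<longrightarrow>
        (\<exists>(J::nat) (P :: nat \<Rightarrow> (real ^ 'd) set).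
          (\<forall>j\<in>{1..J}. affine (P j) \<and> P j \<noteq> {} \<and> aff_dim (P j) \<le> 1) \<and>
          real (card (S \<inter> (\<Union>j\<in>{1..J}. P j))) \<ge> (1 - \<eta>) * real (card S) \<and>
          real J \<le> 2 ^ (?t + 1) *
            (1 / \<eta>\<^sup>2 * ((fourier_L1_norm m A)\<^sup>2 / (real (card D) / real (card A)))) ^ ?t)) \<and>
      fourier_L1_norm m A \<ge> 1/2 * real (card A) powr (1 / (2 * real ?t)) *
        (real (card D) / real (card A)) powr ((real ?t + 1) / (2 * real ?t))"
    if A: "A \<subseteq> int_lattice m" "finite A" "A \<noteq> {}" and D: "D \<subseteq> A" "D \<noteq> {}"
      and "h \<ge> 2" and S: "S \<subseteq> lattice_sphere R" and iso: "freiman_iso h \<phi> D S"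
    for m h R :: nat and A D :: "(nat \<Rightarrow> int) set" and S :: "(real ^ 'd) set" and \<phi>
  proof -
    let ?L = "fourier_L1_norm m A"
    have k: "0 < real (card D)" and a: "0 < real (card A)"
      using A D finite_subset by (auto simp: card_gt_0_iff)
    have L: "0 \<le> ?L"
      unfolding fourier_L1_norm_def by simp
    have le: "real (card D) ^ (?t + 1) \<le> 2 ^ (?t + 1) * (?L\<^sup>2 * real (card A)) ^ ?t"
      using card_spherical_model[OF A(1,2) D \<open>h \<ge> 2\<close> S iso] assms(1) by simp
    \<comment> \<open>K is ||A||^2 / \<alpha>. As ||A||^2 |A| = K |D|, cancelling |D|^t in
      \<open>le\<close> bounds |D| by 2^(t+1) K^t.\<close>
    define K where "K = ?L\<^sup>2 / (real (card D) / real (card A))"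
    have "0 \<le> K"
      by (simp add: K_def)
    have "real (card D) * real (card D) ^ ?t
        \<le> 2 ^ (?t + 1) * K ^ ?t * real (card D) ^ ?t"
      using le k by (simp add: K_def power_divide power_mult_distrib)
    then have card_le: "real (card D) \<le> 2 ^ (?t + 1) * K ^ ?t"
      using k by (simp only: mult_le_cancel_right_pos zero_less_power)
    have card_S: "card S = card D" and "finite S"
      using iso A D bij_betw_finite[of \<phi> D S] finite_subset[of D A]
      by (auto simp: freiman_iso_def dest: bij_betw_same_card)
    \<comment> \<open>The subspaces are the single points of \<open>S\<close>, enumerated from 1, so
      J = |S| and all of \<open>S\<close> is covered.\<close>
    obtain e where e: "bij_betw e {1..card S} S"
      using \<open>finite S\<close> ex_bij_betw_nat_finite_1 by blast
    have "\<exists>(J::nat) (P :: nat \<Rightarrow> (real ^ 'd) set).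
        (\<forall>j\<in>{1..J}. affine (P j) \<and> P j \<noteq> {} \<and> aff_dim (P j) \<le> 1) \<and>
        real (card (S \<inter> (\<Union>j\<in>{1..J}. P j))) \<ge> (1 - \<eta>) * real (card S) \<and>
        real J \<le> 2 ^ (?t + 1) * (1 / \<eta>\<^sup>2 * K) ^ ?t"
      if \<eta>: "0 < \<eta>" "\<eta> < 1" for \<eta>
    proof (intro exI conjI)
      show "\<forall>j\<in>{1..card S}. affine {e j} \<and> {e j} \<noteq> {} \<and> aff_dim {e j} \<le> 1"
        by simp
      have "(\<Union>j\<in>{1..card S}. {e j}) = S"
        using e by (auto simp: bij_betw_def)
      then show "(1 - \<eta>) * real (card S) \<le> real (card (S \<inter> (\<Union>j\<in>{1..card S}. {e j})))"
        using \<eta> by (simp add: mult_left_le_one_le)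
      \<comment> \<open>The factor 1/\<eta>^2 only enlarges the bound already obtained for
        |S|.\<close>
      have "1 \<le> 1 / \<eta>\<^sup>2"
        using \<eta> by (simp add: power_le_one)
      then have "1 * K \<le> 1 / \<eta>\<^sup>2 * K"
        using \<open>0 \<le> K\<close> by (rule mult_right_mono)
      then have "K ^ ?t \<le> (1 / \<eta>\<^sup>2 * K) ^ ?t"
        using \<open>0 \<le> K\<close> by (intro power_mono) auto
      then have "2 ^ (?t + 1) * K ^ ?t \<le> 2 ^ (?t + 1) * (1 / \<eta>\<^sup>2 * K) ^ ?t"
        by (intro mult_left_mono) auto
      with card_le show "real (card S) \<le> 2 ^ (?t + 1) * (1 / \<eta>\<^sup>2 * K) ^ ?t"
        unfolding card_S by linarith
    qed
    then show ?thesis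
      using L1_norm_lower_bound[OF k a L t le] unfolding K_def by blast
  qed
  show ?thesis
    unfolding Let_def
    by (rule exI[of _ "2 ^ (?t + 1)"], rule conjI, simp, rule exI[of _ "1/2"], rule conjI, simp)
       (intro allI impI, elim conjE, rule main)
qed

end
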